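(* Let $\Gamma\subseteq\mathcal{A}$ and let $Y_1,Y_2\subseteq St$ be fixed. The function $solve_{op}(Y_1,\mathcal{V}_M)$ for a unary operator $op$ and $solve_{op}(Y_1,Y_2,\mathcal{V}_M)$ for a binary operator $op$ is (i) positive monotonic w.r.t. $VB$ for $op\in\{\wedge,\langle\langle\Gamma\rangle\rangle\mathrm{X},\langle\langle\Gamma\rangle\rangle\mathrm{G},\langle\langle\Gamma\rangle\rangle\mathrm{U}\}$; (ii) negative monotonic w.r.t. $VB$ for $op=\neg$; (iii) positive and negative monotonic w.r.t. $TB_i$ for $i\in\mathcal{A}$ and $op\in\{\neg,\wedge\}$; (iv) positive monotonic w.r.t. $TB_i$ for $i\in\Gamma$ and $op\in\{\langle\langle\Gamma\rangle\rangle\mathrm{X},\langle\langle\Gamma\rangle\rangle\mathrm{G},\langle\langle\Gamma\rangle\rangle\mathrm{U}\}$; (v) negative monotonic w.r.t. $TB_i$ for $i\in\mathcal{A}\setminus\Gamma$ and $op\in\{\langle\langle\Gamma\rangle\rangle\mathrm{X},\langle\langle\Gamma\rangle\rangle\mathrm{G},\langle\langle\Gamma\rangle\rangle\mathrm{U}\}$.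
   Context: Fix a set of agents $\mathcal{A}=\{1,\dots,n\}$, a finite set $\mathcal{PV}$ of propositional variables, and for each agent $i$ a finite set of local states $L_i=\{l_i^1,\dots,l_i^{n_i}\}$. Agent $i$ has actions $Act_i=\{a_i^1,\dots,a_i^{n_i}\}$ and a local protocol $P_i:L_i\to 2^{Act_i}$ with $P_i(l)\neq\emptyset$ for all $l$; its local transition function is $T_i(l_i^k,a_i^j)=l_i^j$, defined iff $a_i^j\in P_i(l_i^k)$. A model is $M=(St,T,V)$ with $St=L_1\times\dots\times L_n$, global actions $Act=Act_1\times\dots\times Act_n$, global transition $T(g,a)=g'$ iff $T_i(g^i,a^i)=g'^i$ for all $i$, and valuation $V:St\to 2^{\mathcal{PV}}$. Encoding: $P_i$ is a Boolean $n_i\times n_i$ table (entry $(l,a)$ is $1$ iff $a\in P_i(l)$) flattened into $tb_i$; $V$ is a bit vector $vb$ of length $|St|\cdot|\mathcal{PV}|$ (entry $(g,p)$ is $1$ iff $p\in V(g)$). The model is encoded by $v_M=(tb_1,\dots,tb_n,vb)$; $\mathcal{V}_M=(TB_1,\dots,TB_n,VB)$ is the corresponding vector of Boolean variables; only vectors encoding models (each local state has at least one available action) are considered. A path from $g$ is $g_0a_0g_1a_1\dots$ with $g_0=g$, $T(g_k,a_k)=g_{k+1}$; $\pi[k]=g_k$. A strategy of agent $i$ is $\sigma_i:St\to Act_i$ with $\sigma_i(g)\in P_i(g^i)$; a joint strategy $\sigma_\Gamma$ is a tuple of strategies of agents in $\Gamma$; $out_M(g,\sigma_\Gamma)$ is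 the set of paths from $g$ with $a_k^j=\sigma_j(g_k)$ for all $k$ and $j\in\Gamma$. For the model $M$ encoded by $v_M$ and $Y,Y_1,Y_2\subseteq St$: $solve_\neg(Y,v_M)=St\setminus Y$; $solve_\wedge(Y_1,Y_2,v_M)=Y_1\cap Y_2$; $solve_{\langle\langle\Gamma\rangle\rangle\mathrm{X}}(Y,v_M)$ is the set of $g$ such that some $\sigma_\Gamma$ has $out_M(g,\sigma_\Gamma)\neq\emptyset$ and $\pi[1]\in Y$ for all $\pi$ in it; $solve_{\langle\langle\Gamma\rangle\rangle\mathrm{G}}(Y,v_M)$ is the set of $g$ such that some $\sigma_\Gamma$ has nonempty outcome and $\pi[k]\in Y$ for all $k\ge0$ and all $\pi$ in it; $solve_{\langle\langle\Gamma\rangle\rangle\mathrm{U}}(Y_1,Y_2,v_M)$ is the set of $g$ such that some $\sigma_\Gamma$ has nonempty outcome and every $\pi$ in it has $k\ge0$ with $\pi[k]\in Y_2$ and $\pi[j]\in Y_1$ for $j<k$. A set-valued function $F$ of bit vectors is positive (resp. negative) monotonic w.r.t. a set $W$ of its variables if changing any single variable of $W$ from $0$ to $1$ (resp. from $1$ to $0$), others fixed, yields a value $\supseteq$ the original value. *)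

theory Defs
  imports Complex_Main "HOL-Library.FuncSet"
begin

text \<open>The agents are \<open>1, \<dots>, n\<close>.  The local state \<open>l\<^sub>i\<^sup>k\<close> and the action \<open>a\<^sub>i\<^sup>k\<close>
  of agent \<open>i\<close> are both represented by the index \<open>k \<in> {1..n\<^sub>i}\<close>.  A global state (global action)
  is a tuple of local states (actions), i.e. an extensional function on the set of agents.\<close>

record 'p signat =
  num_agents :: nat
  num_locals :: "nat \<Rightarrow> nat"
  prop_vars  :: "'p set"

type_synonym agent = nat
type_synonym lstate = nat
type_synonym laction = nat
type_synonym gstate = "agent \<Rightarrow> lstate"
type_synonym gaction = "agent \<Rightarrow> laction"

definition agents :: "'p signat \<Rightarrow> agent set" where
  "agents S = {1..num_agents S}"

definition locals :: "'p signat \<Rightarrow> agent \<Rightarrow> lstate set" where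
  "locals S i = {1..num_locals S i}"

definition actions :: "'p signat \<Rightarrow> agent \<Rightarrow> laction set" where
  "actions S i = {1..num_locals S i}"

definition states :: "'p signat \<Rightarrow> gstate set" where
  "states S = (\<Pi>\<^sub>E i\<in>agents S. locals S i)"

definition gactions :: "'p signat \<Rightarrow> gaction set" where
  "gactions S = (\<Pi>\<^sub>E i\<in>agents S. actions S i)"

text \<open>The states and transitions of a model are determined by the signature and the local
  protocols, so only the protocols and the valuation are recorded.\<close>

record 'p model =
  prot :: "agent \<Rightarrow> lstate \<Rightarrow> laction set"
  val  :: "gstate \<Rightarrow> 'p set"

definition models :: "'p signat \<Rightarrow> 'p model set" where
  "models S = {M.
     prot M \<in> (\<Pi>\<^sub>E i\<in>agents S. locals S i \<rightarrow>\<^sub>E {A. A \<subseteq> actions S i \<and> A \<noteq> {}}) \<and>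
     val M \<in> states S \<rightarrow>\<^sub>E Pow (prop_vars S)}"

text \<open>\<open>T\<^sub>i(l\<^sub>i\<^sup>k, a\<^sub>i\<^sup>j) = l\<^sub>i\<^sup>j\<close>: the successor has the same index as the action.\<close>

definition local_trans :: "'p model \<Rightarrow> agent \<Rightarrow> lstate \<Rightarrow> laction \<Rightarrow> lstate option" where
  "local_trans M i l a = (if a \<in> prot M i l then Some a else None)"

definition trans_to :: "'p signat \<Rightarrow> 'p model \<Rightarrow> gstate \<Rightarrow> gaction \<Rightarrow> gstate \<Rightarrow> bool" where
  "trans_to S M g a g' \<longleftrightarrow> g \<in> states S \<and> a \<in> gactions S \<and> g' \<in> states S \<and>
     (\<forall>i\<in>agents S. local_trans M i (g i) (a i) = Some (g' i))"

text \<open>A path \<open>g\<^sub>0 a\<^sub>0 g\<^sub>1 a\<^sub>1 \<dots>\<close> is the pair of its state sequence and its action sequence.\<close>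

type_synonym path = "(nat \<Rightarrow> gstate) \<times> (nat \<Rightarrow> gaction)"

definition paths_from :: "'p signat \<Rightarrow> 'p model \<Rightarrow> gstate \<Rightarrow> path set" where
  "paths_from S M g =
     {\<pi>. fst \<pi> 0 = g \<and> (\<forall>k. trans_to S M (fst \<pi> k) (snd \<pi> k) (fst \<pi> (Suc k)))}"

definition strategies :: "'p signat \<Rightarrow> 'p model \<Rightarrow> agent \<Rightarrow> (gstate \<Rightarrow> laction) set" where
  "strategies S M i = {s \<in> states S \<rightarrow>\<^sub>E actions S i. \<forall>g\<in>states S. s g \<in> prot M i (g i)}"

definition joint_strategies ::
    "'p signat \<Rightarrow> 'p model \<Rightarrow> agent set \<Rightarrow> (agent \<Rightarrow> gstate \<Rightarrow> laction) set" where
  "joint_strategies S M \<Gamma> = (\<Pi>\<^sub>E i\<in>\<Gamma>. strategies S M i)"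

definition outcome ::
    "'p signat \<Rightarrow> 'p model \<Rightarrow> gstate \<Rightarrow> agent set \<Rightarrow> (agent \<Rightarrow> gstate \<Rightarrow> laction) \<Rightarrow> path set" where
  "outcome S M g \<Gamma> \<sigma> =
     {\<pi> \<in> paths_from S M g. \<forall>k. \<forall>j\<in>\<Gamma>. snd \<pi> k j = \<sigma> j (fst \<pi> k)}"

text \<open>Boolean variables encoding a model: \<open>TBvar i l a\<close> is entry \<open>(l, a)\<close> of the protocol table
  of agent \<open>i\<close>, \<open>VBvar g p\<close> is entry \<open>(g, p)\<close> of the valuation vector.  Bit vectors are indexed
  directly by these variables instead of by positions after flattening; they are \<open>False\<close> at indices
  that lie outside the signature.\<close>

datatype 'p bvar = TBvar agent lstate laction | VBvar gstate 'p

type_synonym 'p bitvec = "'p bvar \<Rightarrow> bool"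

definition TB :: "'p signat \<Rightarrow> agent \<Rightarrow> 'p bvar set" where
  "TB S i = {TBvar i l a | l a. l \<in> locals S i \<and> a \<in> actions S i}"

definition VB :: "'p signat \<Rightarrow> 'p bvar set" where
  "VB S = {VBvar g p | g p. g \<in> states S \<and> p \<in> prop_vars S}"

definition encode :: "'p signat \<Rightarrow> 'p model \<Rightarrow> 'p bitvec" where
  "encode S M x = (case x of
       TBvar i l a \<Rightarrow> i \<in> agents S \<and> l \<in> locals S i \<and> a \<in> actions S i \<and> a \<in> prot M i l
     | VBvar g p \<Rightarrow> g \<in> states S \<and> p \<in> prop_vars S \<and> p \<in> val M g)"

definition decode :: "'p signat \<Rightarrow> 'p bitvec \<Rightarrow> 'p model" where
  "decode S v = \<lparr>
     prot = (\<lambda>i\<in>agents S. \<lambda>l\<in>locals S i. {a \<in> actions S i. v (TBvar i l a)}),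
     val = (\<lambda>g\<in>states S. {p \<in> prop_vars S. v (VBvar g p)})\<rparr>"

definition model_vectors :: "'p signat \<Rightarrow> 'p bitvec set" where
  "model_vectors S = encode S ` models S"

lemma decode_encode:
  assumes "M \<in> models S"
  shows "decode S (encode S M) = M"
proof -
  have P: "prot M \<in> (\<Pi>\<^sub>E i\<in>agents S. locals S i \<rightarrow>\<^sub>E {A. A \<subseteq> actions S i \<and> A \<noteq> {}})"
    and V: "val M \<in> states S \<rightarrow>\<^sub>E Pow (prop_vars S)"
    using assms by (auto simp: models_def)
  have "prot (decode S (encode S M)) i l = prot M i l" for i l
  proof (cases "i \<in> agents S")
    case True
    then have Pi: "prot M i \<in> locals S i \<rightarrow>\<^sub>E {A. A \<subseteq> actions S i \<and> A \<noteq> {}}"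
      using P by (rule PiE_mem[rotated])
    show ?thesis
    proof (cases "l \<in> locals S i")
      case l: True
      have "prot M i l \<subseteq> actions S i"
        using PiE_mem[OF Pi l] by simp
      then show ?thesis
        using True l by (auto simp: decode_def encode_def)
    next
      case False
      then show ?thesis
        using True PiE_arb[OF Pi False] by (simp add: decode_def)
    qed
  next
    case False
    then show ?thesis
      using PiE_arb[OF P False] by (simp add: decode_def)
  qed
  moreover have "val (decode S (encode S M)) g = val M g" for g
  proof (cases "g \<in> states S")
    case True
    then show ?thesis
      using PiE_mem[OF V True] by (auto simp: decode_def encode_def)
  next
    case False
    then show ?thesis
      using PiE_arb[OF V False] by (simp add: decode_def)
  qed
  ultimately show ?thesis
    by (intro model.equality ext) simp_all
qed

definition solve_not :: "'p signat \<Rightarrow> gstate set \<Rightarrow> 'p bitvec \<Rightarrow> gstate set" where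
  "solve_not S Y v = states S - Y"

definition solve_and ::
    "'p signat \<Rightarrow> gstate set \<Rightarrow> gstate set \<Rightarrow> 'p bitvec \<Rightarrow> gstate set" where
  "solve_and S Y1 Y2 v = Y1 \<inter> Y2"

definition solve_X ::
    "'p signat \<Rightarrow> agent set \<Rightarrow> gstate set \<Rightarrow> 'p bitvec \<Rightarrow> gstate set" where
  "solve_X S \<Gamma> Y v = {g \<in> states S.
     \<exists>\<sigma>\<in>joint_strategies S (decode S v) \<Gamma>.
       outcome S (decode S v) g \<Gamma> \<sigma> \<noteq> {} \<and>
       (\<forall>\<pi>\<in>outcome S (decode S v) g \<Gamma> \<sigma>. fst \<pi> 1 \<in> Y)}"

definition solve_G ::
    "'p signat \<Rightarrow> agent set \<Rightarrow> gstate set \<Rightarrow> 'p bitvec \<Rightarrow> gstate set" where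
  "solve_G S \<Gamma> Y v = {g \<in> states S.
     \<exists>\<sigma>\<in>joint_strategies S (decode S v) \<Gamma>.
       outcome S (decode S v) g \<Gamma> \<sigma> \<noteq> {} \<and>
       (\<forall>\<pi>\<in>outcome S (decode S v) g \<Gamma> \<sigma>. \<forall>k. fst \<pi> k \<in> Y)}"

definition solve_U ::
    "'p signat \<Rightarrow> agent set \<Rightarrow> gstate set \<Rightarrow> gstate set \<Rightarrow> 'p bitvec \<Rightarrow> gstate set" where
  "solve_U S \<Gamma> Y1 Y2 v = {g \<in> states S.
     \<exists>\<sigma>\<in>joint_strategies S (decode S v) \<Gamma>.
       outcome S (decode S v) g \<Gamma> \<sigma> \<noteq> {} \<and>
       (\<forall>\<pi>\<in>outcome S (decode S v) g \<Gamma> \<sigma>. \<exists>k. fst \<pi> k \<in> Y2 \<and> (\<forall>j<k. fst \<pi> j \<in> Y1))}"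

text \<open>Monotonicity of a set-valued function \<open>F\<close> of bit vectors with domain \<open>D\<close> with respect to a
  set \<open>W\<close> of variables.  Both the original and the modified vector have to lie in \<open>D\<close>: clearing the
  last available action of a local state does not give the encoding of a model.\<close>

definition pos_monotonic ::
    "('x \<Rightarrow> bool) set \<Rightarrow> (('x \<Rightarrow> bool) \<Rightarrow> 'b set) \<Rightarrow> 'x set \<Rightarrow> bool" where
  "pos_monotonic D F W \<longleftrightarrow>
     (\<forall>v\<in>D. \<forall>x\<in>W. \<not> v x \<longrightarrow> v(x := True) \<in> D \<longrightarrow> F v \<subseteq> F (v(x := True)))"

definition neg_monotonic ::
    "('x \<Rightarrow> bool) set \<Rightarrow> (('x \<Rightarrow> bool) \<Rightarrow> 'b set) \<Rightarrow> 'x set \<Rightarrow> bool" where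
  "neg_monotonic D F W \<longleftrightarrow>
     (\<forall>v\<in>D. \<forall>x\<in>W. v x \<longrightarrow> v(x := False) \<in> D \<longrightarrow> F v \<subseteq> F (v(x := False)))"

end

theory Submission
  imports Defs
begin

text \<open>Replace a model by one with larger protocols for the agents in \<open>\<Gamma>\<close> and smaller ones for the
  other agents.  Every joint strategy of \<open>\<Gamma>\<close> remains available, and it has fewer outcomes,
  since the moves of \<open>\<Gamma>\<close> are fixed by the strategy while the opponents have fewer options.  The
  outcome stays nonempty because every local state has an available action.  Hence whatever \<open>\<Gamma>\<close>
  could enforce before, it can still enforce.  Flipping a valuation bit leaves the protocols
  unchanged.\<close>

text \<open>Common form of the three strategic operators: they differ only in the condition
  \<open>P\<close> on the state sequence, so monotonicity is proved once for arbitrary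
  \<open>P\<close>.\<close>

definition enforceable ::
    "'p signat \<Rightarrow> 'p model \<Rightarrow> agent set \<Rightarrow> ((nat \<Rightarrow> gstate) \<Rightarrow> bool) \<Rightarrow> gstate set" where
  "enforceable S M \<Gamma> P = {g \<in> states S.
     \<exists>\<sigma>\<in>joint_strategies S M \<Gamma>.
       outcome S M g \<Gamma> \<sigma> \<noteq> {} \<and> (\<forall>\<pi>\<in>outcome S M g \<Gamma> \<sigma>. P (fst \<pi>))}"

lemma solve_X_eq_enforceable:
  "solve_X S \<Gamma> Y v = enforceable S (decode S v) \<Gamma> (\<lambda>s. s 1 \<in> Y)"
  by (simp add: solve_X_def enforceable_def)

lemma solve_G_eq_enforceable:
  "solve_G S \<Gamma> Y v = enforceable S (decode S v) \<Gamma> (\<lambda>s. \<forall>k. s k \<in> Y)"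
  by (simp add: solve_G_def enforceable_def)

lemma solve_U_eq_enforceable:
  "solve_U S \<Gamma> Y1 Y2 v =
     enforceable S (decode S v) \<Gamma> (\<lambda>s. \<exists>k. s k \<in> Y2 \<and> (\<forall>j<k. s j \<in> Y1))"
  by (simp add: solve_U_def enforceable_def)

lemma state_component: "g \<in> states S \<Longrightarrow> i \<in> agents S \<Longrightarrow> g i \<in> locals S i"
  unfolding states_def by (rule PiE_mem)

text \<open>Local states and actions share their indices, so a joint action can itself be read as a
  global state.\<close>

lemma gactions_eq_states: "gactions S = states S"
  by (simp add: gactions_def states_def actions_def locals_def)

text \<open>Each local transition moves to the state with the index of the chosen action. Thus
  \<open>g'\<close> and \<open>a\<close> agree on all agents, and extensionality makes them
  equal.\<close>

lemma trans_to_iff: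
  "trans_to S M g a g' \<longleftrightarrow>
     g \<in> states S \<and> a \<in> states S \<and> g' = a \<and> (\<forall>i\<in>agents S. a i \<in> prot M i (g i))"
proof -
  have "g' = a" if "g' \<in> states S" "a \<in> states S" "\<And>i. i \<in> agents S \<Longrightarrow> g' i = a i"
    using that unfolding states_def by (rule PiE_ext)
  then show ?thesis
    by (auto simp: trans_to_def local_trans_def gactions_eq_states split: if_splits)
qed

lemma joint_strategy_available:
  assumes "\<sigma> \<in> joint_strategies S M \<Gamma>" "i \<in> \<Gamma>" "g \<in> states S"
  shows "\<sigma> i g \<in> prot M i (g i)"
proof -
  have "\<sigma> i \<in> strategies S M i"
    using assms(1,2) unfolding joint_strategies_def by (rule PiE_mem)
  then show ?thesis
    using assms(3) by (simp add: strategies_def)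
qed

lemma models_protD:
  assumes "M \<in> models S" "i \<in> agents S" "l \<in> locals S i"
  shows "prot M i l \<subseteq> actions S i" "prot M i l \<noteq> {}"
proof -
  have "prot M \<in> (\<Pi>\<^sub>E i\<in>agents S. locals S i \<rightarrow>\<^sub>E {A. A \<subseteq> actions S i \<and> A \<noteq> {}})"
    using assms(1) by (simp add: models_def)
  from PiE_mem[OF PiE_mem[OF this assms(2)] assms(3)]
  show "prot M i l \<subseteq> actions S i" "prot M i l \<noteq> {}" by simp_all
qed

text \<open>There are no deadlocks: the coalition follows \<open>\<sigma>\<close>, every other agent
  takes some available action, and iterating this gives a path.\<close>

lemma outcome_nonempty:
  assumes \<Gamma>: "\<Gamma> \<subseteq> agents S" and M: "M \<in> models S"
    and \<sigma>: "\<sigma> \<in> joint_strategies S M \<Gamma>" and g: "g \<in> states S"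
  shows "outcome S M g \<Gamma> \<sigma> \<noteq> {}"
proof -
  \<comment> \<open>\<open>step h\<close> serves both as the joint action played at \<open>h\<close>
    and as the successor state. The choice by \<open>SOME\<close> is sound because protocols of
    models are nonempty.\<close>
  define step where
    "step h = (\<lambda>i\<in>agents S. if i \<in> \<Gamma> then \<sigma> i h else SOME a. a \<in> prot M i (h i))" for h
  define run where "run k = (step ^^ k) g" for k
  have avail: "step h i \<in> prot M i (h i)" if "h \<in> states S" "i \<in> agents S" for h i
    using joint_strategy_available[OF \<sigma> _ that(1)] that(2)
      models_protD(2)[OF M that(2) state_component[OF that]]
    by (auto simp: step_def some_in_eq)
  have step: "step h \<in> states S" if "h \<in> states S" for h
  proof -
    have "step h i \<in> locals S i" if "i \<in> agents S" for i
      using avail models_protD(1)[OF M] \<open>h \<in> states S\<close> that state_component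
      unfolding actions_def locals_def by blast
    then show ?thesis
      by (auto simp: states_def step_def)
  qed
  have run: "run k \<in> states S" for k
    by (induction k) (simp_all add: run_def g step)
  have run_Suc: "run (Suc k) = step (run k)" for k
    by (simp add: run_def)
  \<comment> \<open>The action sequence of the path is the state sequence shifted by one.\<close>
  have "trans_to S M (run k) (run (Suc k)) (run (Suc k))" for k
    using run avail by (simp add: trans_to_iff run_Suc step)
  moreover have "run (Suc k) j = \<sigma> j (run k)" if "j \<in> \<Gamma>" "j \<in> agents S" for j k
    using that by (simp add: run_Suc step_def)
  ultimately have "(run, \<lambda>k. run (Suc k)) \<in> outcome S M g \<Gamma> \<sigma>"
    using \<Gamma> by (auto simp: outcome_def paths_from_def run_def)
  then show ?thesis by blast
qed

text \<open>A strategy consults the protocol only at components \<open>g i\<close> of global states,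
  and these are local states of \<open>i\<close>, where the inclusion is assumed.\<close>

lemma joint_strategies_mono:
  assumes "\<Gamma> \<subseteq> agents S"
    and "\<And>i l. i \<in> \<Gamma> \<Longrightarrow> l \<in> locals S i \<Longrightarrow> prot M i l \<subseteq> prot M' i l"
  shows "joint_strategies S M \<Gamma> \<subseteq> joint_strategies S M' \<Gamma>"
  unfolding joint_strategies_def
proof (rule PiE_mono)
  show "strategies S M i \<subseteq> strategies S M' i" if "i \<in> \<Gamma>" for i
    using assms(2)[OF that] assms(1) that state_component[of _ S i]
    unfolding strategies_def by blast
qed

text \<open>Each move on a path of \<open>M'\<close> is legal in \<open>M\<close>: coalition moves
  are dictated by \<open>\<sigma>\<close>, which is a strategy in \<open>M\<close>, and opponent
  moves are legal by the inclusion of protocols.\<close>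

lemma outcome_antimono:
  assumes \<sigma>: "\<sigma> \<in> joint_strategies S M \<Gamma>"
    and opp: "\<And>i l. i \<in> agents S - \<Gamma> \<Longrightarrow> l \<in> locals S i \<Longrightarrow> prot M' i l \<subseteq> prot M i l"
  shows "outcome S M' g \<Gamma> \<sigma> \<subseteq> outcome S M g \<Gamma> \<sigma>"
proof
  fix \<pi> assume \<pi>: "\<pi> \<in> outcome S M' g \<Gamma> \<sigma>"
  have "trans_to S M (fst \<pi> k) (snd \<pi> k) (fst \<pi> (Suc k))" for k
  proof -
    have T: "trans_to S M' (fst \<pi> k) (snd \<pi> k) (fst \<pi> (Suc k))"
      using \<pi> by (simp add: outcome_def paths_from_def)
    then have st: "fst \<pi> k \<in> states S"
      by (simp add: trans_to_iff)
    have "snd \<pi> k i \<in> prot M i (fst \<pi> k i)" if i: "i \<in> agents S" for i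
    proof (cases "i \<in> \<Gamma>")
      case True
      then show ?thesis
        using \<pi> joint_strategy_available[OF \<sigma> True st] by (simp add: outcome_def)
    next
      case False
      then show ?thesis
        using opp[of i "fst \<pi> k i"] T i state_component[OF st i] by (auto simp: trans_to_iff)
    qed
    then show ?thesis
      using T by (simp add: trans_to_iff)
  qed
  then show "\<pi> \<in> outcome S M g \<Gamma> \<sigma>"
    using \<pi> by (simp add: outcome_def paths_from_def)
qed

lemma enforceable_mono:
  assumes "M' \<in> models S" "\<Gamma> \<subseteq> agents S"
    and "\<And>i l. i \<in> \<Gamma> \<Longrightarrow> l \<in> locals S i \<Longrightarrow> prot M i l \<subseteq> prot M' i l"
    and "\<And>i l. i \<in> agents S - \<Gamma> \<Longrightarrow> l \<in> locals S i \<Longrightarrow> prot M' i l \<subseteq> prot M i l"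
  shows "enforceable S M \<Gamma> P \<subseteq> enforceable S M' \<Gamma> P"
proof
  fix g assume "g \<in> enforceable S M \<Gamma> P"
  then obtain \<sigma> where g: "g \<in> states S" and \<sigma>: "\<sigma> \<in> joint_strategies S M \<Gamma>"
    and win: "\<forall>\<pi>\<in>outcome S M g \<Gamma> \<sigma>. P (fst \<pi>)"
    by (auto simp: enforceable_def)
  have "\<sigma> \<in> joint_strategies S M' \<Gamma>"
    using joint_strategies_mono[OF assms(2,3)] \<sigma> by blast
  \<comment> \<open>Nonemptiness is not inherited from \<open>M\<close>, since the outcome set may
    shrink; it comes from \<open>M'\<close> being a model.\<close>
  moreover from this have "outcome S M' g \<Gamma> \<sigma> \<noteq> {}"
    using outcome_nonempty assms(1,2) g by blast
  moreover have "\<forall>\<pi>\<in>outcome S M' g \<Gamma> \<sigma>. P (fst \<pi>)"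
    using outcome_antimono[OF \<sigma> assms(4)] win by blast
  ultimately show "g \<in> enforceable S M' \<Gamma> P"
    using g by (auto simp: enforceable_def)
qed

lemma decode_in_models: "v \<in> model_vectors S \<Longrightarrow> decode S v \<in> models S"
  by (auto simp: model_vectors_def decode_encode)

lemma prot_decode:
  "i \<in> agents S \<Longrightarrow> l \<in> locals S i \<Longrightarrow>
     prot (decode S v) i l = {a \<in> actions S i. v (TBvar i l a)}"
  by (simp add: decode_def)

lemma enforceable_pos_monotonic_VB:
  assumes "\<Gamma> \<subseteq> agents S"
  shows "pos_monotonic (model_vectors S) (\<lambda>v. enforceable S (decode S v) \<Gamma> P) (VB S)"
  unfolding pos_monotonic_def
proof (intro ballI impI)
  fix v x
  assume "x \<in> VB S" and v': "v(x := True) \<in> model_vectors S"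
  \<comment> \<open>Only a valuation bit changes, so both protocol inclusions hold with
    equality.\<close>
  then have "prot (decode S (v(x := True))) = prot (decode S v)"
    by (auto simp: VB_def decode_def)
  then show "enforceable S (decode S v) \<Gamma> P \<subseteq> enforceable S (decode S (v(x := True))) \<Gamma> P"
    by (intro enforceable_mono decode_in_models v' assms) simp_all
qed

text \<open>Setting the bit gives a coalition member one more action at one local state; all
  opponents keep their protocols.\<close>

lemma enforceable_pos_monotonic_TB:
  assumes "\<Gamma> \<subseteq> agents S" "i \<in> \<Gamma>"
  shows "pos_monotonic (model_vectors S) (\<lambda>v. enforceable S (decode S v) \<Gamma> P) (TB S i)"
  unfolding pos_monotonic_def
proof (intro ballI impI)
  fix v x
  assume x: "x \<in> TB S i" and v': "v(x := True) \<in> model_vectors S"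
  show "enforceable S (decode S v) \<Gamma> P \<subseteq> enforceable S (decode S (v(x := True))) \<Gamma> P"
    by (rule enforceable_mono[OF decode_in_models[OF v'] assms(1)])
      (use assms x in \<open>auto simp: prot_decode TB_def subset_iff\<close>)
qed

text \<open>Clearing the bit takes one action from an opponent. That the new vector still encodes a
  model guarantees that the local state keeps some action.\<close>

lemma enforceable_neg_monotonic_TB:
  assumes "\<Gamma> \<subseteq> agents S" "i \<in> agents S - \<Gamma>"
  shows "neg_monotonic (model_vectors S) (\<lambda>v. enforceable S (decode S v) \<Gamma> P) (TB S i)"
  unfolding neg_monotonic_def
proof (intro ballI impI)
  fix v x
  assume x: "x \<in> TB S i" and v': "v(x := False) \<in> model_vectors S"
  show "enforceable S (decode S v) \<Gamma> P \<subseteq> enforceable S (decode S (v(x := False))) \<Gamma> P"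
    by (rule enforceable_mono[OF decode_in_models[OF v'] assms(1)])
      (use assms x in \<open>auto simp: prot_decode TB_def subset_iff\<close>)
qed

text \<open>For negation and conjunction, whose values do not depend on the bit vector.\<close>

lemma pos_monotonic_const: "pos_monotonic D (\<lambda>_. A) W"
  by (simp add: pos_monotonic_def)

lemma neg_monotonic_const: "neg_monotonic D (\<lambda>_. A) W"
  by (simp add: neg_monotonic_def)

theorem theorem3p9:
  fixes S :: "'p signat" and \<Gamma> :: "agent set" and Y1 Y2 :: "gstate set"
  assumes "finite (prop_vars S)"
    and "\<Gamma> \<subseteq> agents S"
    and "Y1 \<subseteq> states S"
    and "Y2 \<subseteq> states S"
  shows
    "(pos_monotonic (model_vectors S) (solve_and S Y1 Y2) (VB S) \<and>
      pos_monotonic (model_vectors S) (solve_X S \<Gamma> Y1) (VB S) \<and>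
      pos_monotonic (model_vectors S) (solve_G S \<Gamma> Y1) (VB S) \<and>
      pos_monotonic (model_vectors S) (solve_U S \<Gamma> Y1 Y2) (VB S)) \<and>
     neg_monotonic (model_vectors S) (solve_not S Y1) (VB S) \<and>
     (\<forall>i\<in>agents S.
       pos_monotonic (model_vectors S) (solve_not S Y1) (TB S i) \<and>
       neg_monotonic (model_vectors S) (solve_not S Y1) (TB S i) \<and>
       pos_monotonic (model_vectors S) (solve_and S Y1 Y2) (TB S i) \<and>
       neg_monotonic (model_vectors S) (solve_and S Y1 Y2) (TB S i)) \<and>
     (\<forall>i\<in>\<Gamma>.
       pos_monotonic (model_vectors S) (solve_X S \<Gamma> Y1) (TB S i) \<and>
       pos_monotonic (model_vectors S) (solve_G S \<Gamma> Y1) (TB S i) \<and>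
       pos_monotonic (model_vectors S) (solve_U S \<Gamma> Y1 Y2) (TB S i)) \<and>
     (\<forall>i\<in>agents S - \<Gamma>.
       neg_monotonic (model_vectors S) (solve_X S \<Gamma> Y1) (TB S i) \<and>
       neg_monotonic (model_vectors S) (solve_G S \<Gamma> Y1) (TB S i) \<and>
       neg_monotonic (model_vectors S) (solve_U S \<Gamma> Y1 Y2) (TB S i))"
  \<comment> \<open>The operators occur here without their bit vector argument, so the equations are
    rewritten as equations between functions.\<close>
  unfolding solve_X_eq_enforceable[abs_def] solve_G_eq_enforceable[abs_def]
    solve_U_eq_enforceable[abs_def] solve_not_def[abs_def] solve_and_def[abs_def]
  by (intro conjI ballI pos_monotonic_const neg_monotonic_const enforceable_pos_monotonic_VB
      enforceable_pos_monotonic_TB enforceable_neg_monotonic_TB assms)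

end
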